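(* Let $n\ge2$ and $R>0$. For all real-valued $\phi\in C^\infty(\overline{B_R})$, $$\left(\int_{B_R}|\nabla\phi|^2\,dx\right)\left(\int_{B_R}(x_{n-1}^2+x_n^2)|\phi|^2\,dx\right)\ \ge\ \frac{A}{4},$$ where $$A=\left(2\int_{B_R}|\phi|^2\,dx-\frac1R\int_{\partial B_R}(x_{n-1}^2+x_n^2)|\phi|^2\,d\nu\right)^2.$$
   Context: $B_R=\{x\in\mathbb{R}^n:|x|<R\}$ is the open ball of radius $R$ centered at the origin, $x=(x_1,\dots,x_n)$, $\partial B_R$ is the boundary sphere, and $d\nu$ the surface measure on $\partial B_R$. *)

theory Defs
  imports "HOL-Analysis.Analysis"
begin

definition partial_deriv :: "'n::finite \<Rightarrow> (real^'n \<Rightarrow> real) \<Rightarrow> real^'n \<Rightarrow> real" where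
  "partial_deriv i f x = frechet_derivative f (at x) (axis i 1)"

definition gradient :: "(real^'n::finite \<Rightarrow> real) \<Rightarrow> real^'n \<Rightarrow> real^'n" where
  "gradient f x = (\<chi> i. partial_deriv i f x)"

abbreviation iterated_partial :: "'n::finite list \<Rightarrow> (real^'n \<Rightarrow> real) \<Rightarrow> real^'n \<Rightarrow> real" where
  "iterated_partial is f \<equiv> foldr partial_deriv is f"

text \<open>The space of smooth functions up to the boundary of an open set \<open>S\<close>: all iterated partial
  derivatives exist in \<open>S\<close> and extend continuously to the closure. The values of \<open>f\<close> on the boundary
  are those of its own continuous extension; its values off \<open>closure S\<close> are irrelevant.\<close>

definition smooth_up_to_boundary :: "(real^'n::finite) set \<Rightarrow> (real^'n \<Rightarrow> real) \<Rightarrow> bool" where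
  "smooth_up_to_boundary S f \<longleftrightarrow>
     open S \<and> continuous_on (closure S) f \<and>
     (\<forall>is. (\<forall>x\<in>S. iterated_partial is f differentiable (at x)) \<and>
           (\<exists>g. continuous_on (closure S) g \<and> (\<forall>x\<in>S. g x = iterated_partial is f x)))"

text \<open>Surface measure on the sphere of radius \<open>R\<close> about the origin, by the usual cone construction:
  \<open>\<nu>(A) = (n/R) \<lambda>{x. 0 < |x| < R, R x/|x| \<in> A}\<close>. The factor comes from
  \<open>\<lambda>(cone over A) = \<integral>\<^sub>0\<^sup>R (r/R)\<^sup>n\<^sup>-\<^sup>1 \<nu>(A) dr = R \<nu>(A)/n\<close>. As a measure on the whole space it is
  concentrated on the sphere.\<close>

definition sphere_measure :: "real \<Rightarrow> (real^'n::finite) measure" where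
  "sphere_measure R = scale_measure (ennreal (real CARD('n) / R))
     (distr (restrict_space lborel (ball 0 R - {0})) borel (\<lambda>x. (R / norm x) *\<^sub>R x))"

lemma radial_measurable:
  "(\<lambda>x. (R / norm x) *\<^sub>R x) \<in> borel_measurable (restrict_space lborel (ball 0 R - {0 :: real^'n::finite}))"
  by (rule measurable_restrict_space1) measurable

lemma emeasure_sphere_measure:
  assumes "A \<in> sets borel"
  shows "emeasure (sphere_measure R) A = ennreal (real CARD('n) / R) *
    emeasure lborel {x \<in> ball 0 R - {0 :: real^'n::finite}. (R / norm x) *\<^sub>R x \<in> A}"
proof -
  let ?M = "restrict_space lborel (ball 0 R - {0 :: real^'n})"
  have sp: "space ?M = ball 0 R - {0}"
    by (simp add: space_restrict_space)
  have "emeasure (distr ?M borel (\<lambda>x. (R / norm x) *\<^sub>R x)) A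
      = emeasure ?M ((\<lambda>x. (R / norm x) *\<^sub>R x) -` A \<inter> space ?M)"
    by (rule emeasure_distr[OF radial_measurable assms])
  also have "\<dots> = emeasure lborel ((\<lambda>x. (R / norm x) *\<^sub>R x) -` A \<inter> space ?M)"
    by (rule emeasure_restrict_space) (auto simp: sp)
  also have "(\<lambda>x. (R / norm x) *\<^sub>R x) -` A \<inter> space ?M
      = {x \<in> ball 0 R - {0}. (R / norm x) *\<^sub>R x \<in> A}"
    by (auto simp: sp)
  finally show ?thesis
    by (simp add: sphere_measure_def)
qed

lemma emeasure_sphere_measure_off_sphere:
  assumes "R > 0"
  shows "emeasure (sphere_measure R) (- sphere (0 :: real^'n::finite) R) = 0"
proof -
  have "{x \<in> ball 0 R - {0 :: real^'n}. (R / norm x) *\<^sub>R x \<in> - sphere 0 R} = {}"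
    using assms by auto
  then show ?thesis
    by (simp only: emeasure_sphere_measure[of "- sphere 0 R"] borel_open open_Compl
        closed_sphere emeasure_empty mult_zero_right)
qed

lemma emeasure_sphere_measure_sphere:
  assumes "R > 0"
  shows "emeasure (sphere_measure R) (sphere (0 :: real^'n::finite) R) =
    ennreal (real CARD('n) / R) * emeasure lborel (ball (0 :: real^'n) R)"
proof -
  have "{x \<in> ball 0 R - {0 :: real^'n}. (R / norm x) *\<^sub>R x \<in> sphere 0 R} = ball 0 R - {0}"
    using assms by auto
  moreover have "emeasure lborel (ball (0 :: real^'n) R - {0}) = emeasure lborel (ball (0 :: real^'n) R)"
    by (rule emeasure_Diff_null_set) (auto simp: null_sets_def)
  ultimately show ?thesis
    by (simp only: emeasure_sphere_measure[of "sphere 0 R"] borel_closed closed_sphere)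
qed

end

theory Submission
  imports Defs "HOL-Real_Asymp.Real_Asymp"
begin

text \<open>Let \<open>V x\<close> be the projection of \<open>x\<close> to its last two coordinates. The divergence theorem for the
  field \<open>\<phi>\<^sup>2 V\<close> identifies the difference inside the square with \<open>-2 \<integral> \<phi> V \<bullet> \<nabla>\<phi>\<close>, and the
  Cauchy--Schwarz inequality finishes the proof.

  For the divergence theorem on the ball, the integral of a directional derivative of a compactly
  supported Lipschitz function vanishes by translation invariance of Lebesgue measure, applied to
  difference quotients. This is used for \<open>(1 - |x|\<^sup>2\<^sup>m\<^sup>+\<^sup>2 / R\<^sup>2\<^sup>m\<^sup>+\<^sup>2) f\<close>, which vanishes on the sphere.
  As \<open>m\<close> grows, the cutoff tends to 1 while its gradient concentrates on the sphere, and the moments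
  of 0-homogeneous functions show that the limit is the cone measure.\<close>

section \<open>Vanishing integrals of directional derivatives, via difference quotients\<close>

lemma has_derivative_imp_difference_quotient:
  fixes f :: "'a::real_normed_vector \<Rightarrow> real"
  assumes "(f has_derivative f') (at x)"
  shows "((\<lambda>t. (f (x + t *\<^sub>R v) - f x) / t) \<longlongrightarrow> f' v) (at 0)"
proof -
  have "((\<lambda>t. x + t *\<^sub>R v) has_derivative (\<lambda>t. t *\<^sub>R v)) (at 0)"
    by (auto intro!: derivative_eq_intros)
  moreover have "(f has_derivative f') (at (x + 0 *\<^sub>R v))"
    using assms by simp
  ultimately have "((\<lambda>t. f (x + t *\<^sub>R v)) has_derivative (\<lambda>t. f' (t *\<^sub>R v))) (at 0)"
    by (rule has_derivative_compose)
  then have "((\<lambda>t. f (x + t *\<^sub>R v)) has_real_derivative f' v) (at 0)"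
    using bounded_linear.linear[OF has_derivative_bounded_linear[OF assms]]
    by (simp add: has_field_derivative_def linear_cmul mult.commute[of _ "f' v"])
  then show ?thesis
    by (simp add: DERIV_def)
qed

text \<open>Dominated convergence and measurability of pointwise limits are applied to sequences, so
  the step is restricted to \<open>1 / (k + 1)\<close>.\<close>

lemma difference_quotient_sequence:
  assumes "((\<lambda>t::real. q t) \<longlongrightarrow> (l::real)) (at 0)"
  shows "(\<lambda>k. q (inverse (real (Suc k)))) \<longlonglongrightarrow> l"
proof -
  have "filterlim (\<lambda>k. inverse (real (Suc k))) (at 0) sequentially"
    using LIMSEQ_inverse_real_of_nat by (simp add: filterlim_at)
  then show ?thesis
    by (rule filterlim_compose[OF assms])
qed

lemma lborel_integral_translation:
  fixes f :: "'a::euclidean_space \<Rightarrow> real"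
  assumes "f \<in> borel_measurable borel"
  shows "(LINT x|lborel. f (x + c)) = (LINT x|lborel. f x)"
proof -
  have "(LINT x|lborel. f x) = (LINT x|distr lborel borel ((+) c). f x)"
    by (simp add: lborel_distr_plus)
  also have "\<dots> = (LINT x|lborel. f (c + x))"
    using assms by (subst integral_distr) auto
  finally show ?thesis by (simp add: add.commute)
qed

text \<open>Every difference quotient has integral 0 by translation invariance. The quotients share
  the bound \<open>L * norm v\<close> and a bounded support, so dominated convergence passes to the
  limit, which is \<open>d\<close> inside the ball and 0 outside its closure.\<close>

lemma integral_difference_quotient_limit:
  fixes G d :: "'a::euclidean_space \<Rightarrow> real"
  assumes lip: "L-lipschitz_on UNIV G"
    and supp: "\<And>x. R \<le> norm x \<Longrightarrow> G x = 0"
    and lim: "\<And>x. norm x < R \<Longrightarrow> ((\<lambda>t. (G (x + t *\<^sub>R v) - G x) / t) \<longlongrightarrow> d x) (at 0)"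
  shows "(LINT x:ball 0 R|lborel. d x) = 0"
proof -
  define s where "s k = inverse (real (Suc k))" for k
  define q where "q k x = (G (x + s k *\<^sub>R v) - G x) / s k" for k x
  have s: "0 < s k" "s k \<le> 1" for k
    by (auto simp: s_def divide_simps)
  have G: "continuous_on UNIV G"
    using lip by (rule lipschitz_on_continuous_on)
  have [measurable]: "G \<in> borel_measurable borel"
    using G by (rule borel_measurable_continuous_onI)
  have [measurable]: "q k \<in> borel_measurable borel" for k
    unfolding q_def by measurable
  have qlim: "(\<lambda>k. q k x) \<longlonglongrightarrow> d x" if "norm x < R" for x
    unfolding q_def s_def by (rule difference_quotient_sequence[OF lim[OF that]])
  have qbound: "\<bar>q k x\<bar> \<le> L * norm v" for k x
    using lipschitz_on_normD[OF lip, of "x + s k *\<^sub>R v" x] s[of k]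
    by (simp add: q_def divide_simps mult_ac)
  have [measurable]: "ball 0 R \<in> sets (borel :: 'a measure)"
    by simp
  \<comment> \<open>Nothing is known about \<open>d\<close> off the open ball; its cut-off is
    measurable as a pointwise limit of the cut-off quotients.\<close>
  have [measurable]: "(\<lambda>x. indicator (ball 0 R) x * d x) \<in> borel_measurable borel"
  proof (rule borel_measurable_LIMSEQ_real)
    show "(\<lambda>k. indicator (ball 0 R) x * q k x) \<longlonglongrightarrow> indicator (ball 0 R) x * d x" for x
      by (cases "norm x < R") (use qlim in \<open>auto intro!: tendsto_mult_left\<close>)
  qed measurable
  have integrable_G: "integrable lborel G"
  proof -
    have "integrable lborel (\<lambda>x. indicator (cball 0 R) x *\<^sub>R G x)"
      by (rule borel_integrable_compact) (auto intro: continuous_on_subset[OF G])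
    also have "(\<lambda>x. indicator (cball 0 R) x *\<^sub>R G x) = G"
      using supp by (force simp: indicator_def)
    finally show ?thesis .
  qed
  have q0: "integral\<^sup>L lborel (q k) = 0" for k
  proof -
    have "integrable lborel (\<lambda>x. G (x + s k *\<^sub>R v))"
    proof -
      have "integrable (distr lborel borel ((+) (s k *\<^sub>R v))) G"
        using integrable_G by (simp add: lborel_distr_plus)
      then show ?thesis
        by (subst (asm) integrable_distr_eq) (auto simp: add.commute)
    qed
    then show ?thesis
      using integrable_G by (simp add: q_def[abs_def] lborel_integral_translation)
  qed
  have "(\<lambda>k. integral\<^sup>L lborel (q k)) \<longlonglongrightarrow> (LINT x|lborel. indicator (ball 0 R) x * d x)"
  proof (rule integral_dominated_convergence)
    show "integrable lborel (\<lambda>x. indicator (cball 0 (R + norm v)) x *\<^sub>R (L * norm v))"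
      by (rule borel_integrable_compact) auto
    \<comment> \<open>On the sphere itself the quotients need not converge, so this null set is
      discarded.\<close>
    have "AE x in lborel. x \<notin> sphere 0 R"
      using negligible_sphere[of 0 R]
      by (intro AE_not_in) (simp add: negligible_iff_null_sets null_sets_completion_iff)
    then show "AE x in lborel. (\<lambda>k. q k x) \<longlonglongrightarrow> indicator (ball 0 R) x * d x"
    proof (rule AE_mp, intro AE_I2 impI)
      fix x :: 'a assume "x \<notin> sphere 0 R"
      then consider "norm x < R" | "R < norm x" by force
      then show "(\<lambda>k. q k x) \<longlonglongrightarrow> indicator (ball 0 R) x * d x"
      proof cases
        case 1 then show ?thesis using qlim by simp
      next
        \<comment> \<open>For small steps the translated point also lies outside the closed ball, so
          both terms of the quotient vanish.\<close>
        case 2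
        have "s \<longlonglongrightarrow> 0" unfolding s_def by (rule LIMSEQ_inverse_real_of_nat)
        then have "(\<lambda>k. norm (x + s k *\<^sub>R v)) \<longlonglongrightarrow> norm (x + 0 *\<^sub>R v)"
          by (intro tendsto_intros)
        then have "eventually (\<lambda>k. R < norm (x + s k *\<^sub>R v)) sequentially"
          using 2 by (intro order_tendstoD) auto
        then have "eventually (\<lambda>k. q k x = 0) sequentially"
          by eventually_elim (use 2 in \<open>simp add: q_def supp\<close>)
        then show ?thesis using 2 by (simp add: tendsto_eventually)
      qed
    qed
    show "AE x in lborel. norm (q k x) \<le> indicator (cball 0 (R + norm v)) x *\<^sub>R (L * norm v)" for k
    proof (rule AE_I2)
      fix x
      show "norm (q k x) \<le> indicator (cball 0 (R + norm v)) x *\<^sub>R (L * norm v)"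
      proof (cases "norm x \<le> R + norm v")
        case False
        \<comment> \<open>Because \<open>s k \<le> 1\<close>, a point beyond radius
          \<open>R + norm v\<close> stays outside the ball after translation.\<close>
        have "norm (s k *\<^sub>R v) \<le> norm v" using s[of k] mult_right_mono[of "s k" 1 "norm v"] by simp
        moreover have "norm x \<le> norm (x + s k *\<^sub>R v) + norm (s k *\<^sub>R v)"
          by (metis add_diff_cancel_right' norm_triangle_ineq4)
        ultimately have "R \<le> norm (x + s k *\<^sub>R v)" using False by linarith
        moreover have "R \<le> norm x" using False norm_ge_zero[of v] by linarith
        ultimately show ?thesis using False by (simp add: q_def supp)
      qed (use qbound in simp)
    qed
  qed measurable
  then have "(LINT x|lborel. indicator (ball 0 R) x * d x) = 0"
    by (simp add: q0 LIMSEQ_const_iff)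
  then show ?thesis
    by (simp add: set_lebesgue_integral_def)
qed

text \<open>An outside point projects to the relative frontier, which is the sphere because the ball
  has interior. Hence a function that is zero on the sphere, composed with the projection, vanishes
  outside the ball.\<close>

lemma closest_point_cball_sphere:
  fixes x :: "'a::euclidean_space"
  assumes "R > 0" "R \<le> norm x"
  shows "norm (closest_point (cball 0 R) x) = R"
proof (cases "norm x = R")
  case True
  then show ?thesis using closest_point_self[of x "cball 0 R"] by simp
next
  case False
  have "interior (cball (0::'a) R) \<noteq> {}"
    using \<open>R > 0\<close> by simp
  then have "closest_point (cball 0 R) x \<in> frontier (cball 0 R)"
    using closest_point_in_rel_frontier[of "cball 0 R" x] assms False
    by (simp add: rel_frontier_nonempty_interior affine_hull_nonempty_interior rel_interior_nonempty_interior)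
  then show ?thesis using assms by simp
qed

text \<open>Composition with the nearest-point projection extends \<open>G\<close> to the whole
  space. The projection is 1-Lipschitz, so \<open>L\<close> survives; it sends outside points to the
  sphere, where \<open>G\<close> is 0, and fixes inside points, so derivatives there are
  unchanged.\<close>

lemma integral_directional_derivative_ball_eq_0:
  fixes G :: "'a::euclidean_space \<Rightarrow> real"
  assumes "R > 0" and lip: "L-lipschitz_on (cball 0 R) G"
    and zero: "\<And>x. norm x = R \<Longrightarrow> G x = 0"
    and der: "\<And>x. x \<in> ball 0 R \<Longrightarrow> (G has_derivative G' x) (at x)"
  shows "(LINT x:ball 0 R|lborel. G' x v) = 0"
proof (rule integral_difference_quotient_limit)
  let ?p = "closest_point (cball 0 R) :: 'a \<Rightarrow> 'a"
  have p: "?p x \<in> cball 0 R" for x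
    using \<open>R > 0\<close> by (intro closest_point_in_set) auto
  have p_id: "?p x = x" if "norm x \<le> R" for x
    using that by (intro closest_point_self) auto
  show "L-lipschitz_on UNIV (G \<circ> ?p)"
  proof (rule lipschitz_onI)
    fix x y :: 'a
    have "dist (G (?p x)) (G (?p y)) \<le> L * dist (?p x) (?p y)"
      by (rule lipschitz_onD[OF lip p p])
    also have "\<dots> \<le> L * dist x y"
      using \<open>R > 0\<close> lipschitz_on_nonneg[OF lip]
      by (intro mult_left_mono closest_point_lipschitz) auto
    finally show "dist ((G \<circ> ?p) x) ((G \<circ> ?p) y) \<le> L * dist x y" by simp
  qed (rule lipschitz_on_nonneg[OF lip])
  show "(G \<circ> ?p) x = 0" if "R \<le> norm x" for x
    using closest_point_cball_sphere[OF \<open>R > 0\<close> that] zero by simp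
  fix x :: 'a assume x: "norm x < R"
  have "((G \<circ> ?p) has_derivative G' x) (at x)"
  proof (rule has_derivative_transform_within_open)
    show "(G has_derivative G' x) (at x)" using x by (intro der) simp
    show "open (ball 0 R :: 'a set)" "x \<in> ball 0 R" using x by auto
  qed (simp add: p_id)
  then show "((\<lambda>t. ((G \<circ> ?p) (x + t *\<^sub>R v) - (G \<circ> ?p) x) / t) \<longlongrightarrow> G' x v) (at 0)"
    by (rule has_derivative_imp_difference_quotient)
qed

section \<open>Moments of 0-homogeneous functions\<close>

text \<open>The dilation by \<open>c = t / R\<close> maps \<open>ball 0 R\<close> onto
  \<open>ball 0 t\<close>, has Jacobian \<open>c ^ DIM('a)\<close> and leaves \<open>k\<close>
  invariant. For \<open>t = 0\<close> the ball is empty and the power is 0, as the dimension is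
  positive.\<close>

lemma integral_homogeneous_ball_scale:
  fixes k :: "'a::euclidean_space \<Rightarrow> real"
  assumes "R > 0" "0 \<le> t" and [measurable]: "k \<in> borel_measurable borel"
    and hom: "\<And>c x. c > 0 \<Longrightarrow> k (c *\<^sub>R x) = k x"
  shows "(LINT x:ball 0 t|lborel. k x) = (t / R) ^ DIM('a) * (LINT x:ball 0 R|lborel. k x)"
proof (cases "t = 0")
  case False
  define c where "c = t / R"
  have c: "c > 0" using assms False by (simp add: c_def)
  have [measurable]: "ball 0 t \<in> sets (borel :: 'a measure)"
    by simp
  have "(LINT x:ball 0 t|lborel. k x)
      = (LINT x|density (distr lborel borel (\<lambda>x::'a. 0 + c *\<^sub>R x)) (\<lambda>_. \<bar>c\<bar> ^ DIM('a)). indicator (ball 0 t) x * k x)"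
    using c by (subst lborel_affine[of c 0, symmetric]) (simp_all add: set_lebesgue_integral_def)
  also have "\<dots> = (LINT x|distr lborel borel (\<lambda>x::'a. 0 + c *\<^sub>R x). c ^ DIM('a) *\<^sub>R (indicator (ball 0 t) x * k x))"
    using c by (subst integral_density) auto
  also have "\<dots> = (LINT x|lborel. c ^ DIM('a) *\<^sub>R (indicator (ball 0 t) (0 + c *\<^sub>R x) * k (0 + c *\<^sub>R x)))"
    by (rule integral_distr) measurable
  also have "\<dots> = (LINT x|lborel. c ^ DIM('a) * (indicator (ball 0 R) x * k x))"
  proof (rule Bochner_Integration.integral_cong)
    fix x :: 'a
    have "c * norm x < t \<longleftrightarrow> norm x < R"
      using assms False by (simp add: c_def field_simps)
    then show "c ^ DIM('a) *\<^sub>R (indicator (ball 0 t) (0 + c *\<^sub>R x) * k (0 + c *\<^sub>R x))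
        = c ^ DIM('a) * (indicator (ball 0 R) x * k x)"
      using c hom by (simp add: indicator_def)
  qed simp
  finally show ?thesis
    by (simp add: set_lebesgue_integral_def c_def)
qed (simp add: set_lebesgue_integral_def)

text \<open>The primitive is \<open>t ^ p\<close>. The half-open interval is chosen so that, for
  \<open>r = norm x\<close>, the condition \<open>r < t\<close> says exactly that \<open>x\<close>
  lies in \<open>ball 0 t\<close>.\<close>

lemma integral_power_layer:
  fixes r R :: real
  assumes "0 \<le> r" "r < R"
  shows "(LINT t|lborel. real p * t ^ (p - 1) * indicator {r<..R} t) = R ^ p - r ^ p"
proof -
  have "(LINT t|lborel. real p * t ^ (p - 1) * indicator {r<..R} t)
      = (LINT t|lborel. real p * t ^ (p - 1) * indicator {r..R} t)"
    by (intro integral_cong_AE AE_mp[OF AE_lborel_singleton[of r] AE_I2]) (auto simp: indicator_def)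
  also have "\<dots> = R ^ p - r ^ p"
    using assms by (intro integral_FTC_Icc_real) (auto intro!: derivative_eq_intros)
  finally show ?thesis .
qed

text \<open>A layer-cake argument takes the place of polar coordinates:
  \<open>R ^ p - norm x ^ p\<close> is the integral of \<open>p * t ^ (p - 1)\<close> over
  \<open>norm x < t \<le> R\<close>. Exchanging integrals reduces the moment to the integrals of
  \<open>k\<close> over \<open>ball 0 t\<close>, which scale like
  \<open>t ^ DIM('a)\<close>.\<close>

lemma integral_norm_power_homogeneous:
  fixes k :: "'a::euclidean_space \<Rightarrow> real"
  assumes "R > 0" and [measurable]: "k \<in> borel_measurable borel"
    and bound: "\<And>x. \<bar>k x\<bar> \<le> B"
    and hom: "\<And>c x. c > 0 \<Longrightarrow> k (c *\<^sub>R x) = k x"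
  shows "(LINT x:ball 0 R|lborel. norm x ^ p * k x)
    = real DIM('a) / real (DIM('a) + p) * R ^ p * (LINT x:ball 0 R|lborel. k x)"
proof -
  define D where "D = DIM('a)"
  define K where "K = (LINT x:ball 0 R|lborel. k x)"
  define u where "u t = real p * t ^ (p - 1)" for t :: real
  define F where "F x t = indicator (ball 0 R) x * k x * (u t * indicator {norm x<..R} t)" for x :: 'a and t :: real
  have D: "D > 0" by (simp add: D_def)
  have [measurable]: "ball 0 R \<in> sets (borel :: 'a measure)"
    by simp
  have [measurable]: "u \<in> borel_measurable borel"
    unfolding u_def by measurable
  have int: "integrable (lborel \<Otimes>\<^sub>M lborel) (case_prod F)"
  proof (rule integrableI_bounded_set)
    show "ball 0 R \<times> {0..R} \<in> sets (lborel \<Otimes>\<^sub>M lborel)"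
      by (intro pair_measureI) auto
    \<comment> \<open>The interval indicator depends on \<open>x\<close>; writing it as a condition
      on the pair exposes joint measurability.\<close>
    have "(\<lambda>z. indicator (ball 0 R) (fst z) * k (fst z) * (u (snd z)
          * (if norm (fst z) < snd z \<and> snd z \<le> R then 1 else 0)))
        \<in> borel_measurable (lborel \<Otimes>\<^sub>M lborel)"
      by measurable
    moreover have "case_prod F = (\<lambda>z. indicator (ball 0 R) (fst z) * k (fst z) * (u (snd z)
          * (if norm (fst z) < snd z \<and> snd z \<le> R then 1 else 0)))"
      by (auto simp: F_def indicator_def)
    ultimately show "case_prod F \<in> borel_measurable (lborel \<Otimes>\<^sub>M lborel)" by simp
    show "emeasure (lborel \<Otimes>\<^sub>M lborel) (ball (0::'a) R \<times> {0..R}) < \<infinity>"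
      using emeasure_lborel_ball_finite[of "0::'a" R]
      by (subst lborel.emeasure_pair_measure_Times) (auto simp: ennreal_mult_less_top emeasure_lborel_Icc_eq)
    show "AE z in lborel \<Otimes>\<^sub>M lborel. z \<in> ball 0 R \<times> {0..R} \<longrightarrow> norm (case_prod F z) \<le> B * (p * R ^ (p - 1))"
    proof (intro AE_I2 impI)
      fix z :: "'a \<times> real" assume "z \<in> ball 0 R \<times> {0..R}"
      then obtain x t where z: "z = (x, t)" and t: "0 \<le> t" "t \<le> R" by auto
      have "\<bar>u t\<bar> \<le> p * R ^ (p - 1)"
        using t by (auto simp: u_def abs_mult intro!: mult_left_mono power_mono)
      then have "\<bar>k x\<bar> * \<bar>u t\<bar> \<le> B * (p * R ^ (p - 1))"
        using bound[of x] by (intro mult_mono) auto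
      moreover have "\<bar>F x t\<bar> \<le> \<bar>k x\<bar> * \<bar>u t\<bar>"
        by (auto simp: F_def indicator_def abs_mult)
      ultimately show "norm (case_prod F z) \<le> B * (p * R ^ (p - 1))"
        by (simp add: z)
    qed
    show "AE z in lborel \<Otimes>\<^sub>M lborel. z \<notin> ball 0 R \<times> {0..R} \<longrightarrow> case_prod F z = 0"
      by (rule AE_I2) (auto simp: F_def indicator_def dest: order_trans[OF norm_ge_zero less_imp_le])
  qed
  have inner_t: "(LINT t|lborel. F x t) = indicator (ball 0 R) x * (R ^ p * k x - norm x ^ p * k x)" for x
  proof -
    have "(LINT t|lborel. F x t) = indicator (ball 0 R) x * k x * (LINT t|lborel. u t * indicator {norm x<..R} t)"
      by (simp add: F_def)
    moreover have "(LINT t|lborel. u t * indicator {norm x<..R} t) = R ^ p - norm x ^ p" if "x \<in> ball 0 R"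
      using integral_power_layer[of "norm x" R p] that by (simp add: u_def)
    ultimately show ?thesis
      by (cases "x \<in> ball 0 R") (simp_all add: right_diff_distrib mult.commute)
  qed
  have inner_x: "(LINT x|lborel. F x t) = K / R ^ D * (real p * t ^ (p - 1 + D)) * indicator {0..R} t" for t
  proof (cases "0 \<le> t \<and> t \<le> R")
    case True
    have "(LINT x|lborel. F x t) = (LINT x|lborel. u t * (indicator (ball 0 t) x * k x))"
      using True by (intro Bochner_Integration.integral_cong) (auto simp: F_def indicator_def)
    also have "\<dots> = u t * (LINT x:ball 0 t|lborel. k x)"
      by (simp add: set_lebesgue_integral_def)
    also have "\<dots> = u t * ((t / R) ^ D * K)"
      using True \<open>R > 0\<close> hom by (subst integral_homogeneous_ball_scale[of R]) (simp_all add: D_def K_def)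
    finally show ?thesis
      using True by (simp add: u_def power_divide power_add)
  next
    case False
    then have "F x t = 0" for x
      using norm_ge_zero[of x] by (auto simp: F_def indicator_def simp del: norm_ge_zero)
    then show ?thesis using False by simp
  qed
  have set_int: "set_integrable lborel (ball 0 R) (\<lambda>x. norm x ^ q * k x)" for q
    unfolding set_integrable_def
  proof (rule integrableI_bounded_set[where A = "ball 0 R" and B = "R ^ q * B"])
    show "emeasure lborel (ball (0::'a) R) < \<infinity>" by (rule emeasure_lborel_ball_finite)
    show "AE x in lborel. x \<in> ball 0 R \<longrightarrow> norm (indicat_real (ball 0 R) x *\<^sub>R (norm x ^ q * k x)) \<le> R ^ q * B"
      using bound \<open>R > 0\<close> by (intro AE_I2) (auto simp: abs_mult intro!: mult_mono power_mono)
  qed (auto simp: indicator_def)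
  \<comment> \<open>The two iterated integrals of \<open>F\<close> are equated by Fubini; what
    remains is an integral in \<open>t\<close> alone.\<close>
  have "R ^ p * K - (LINT x:ball 0 R|lborel. norm x ^ p * k x)
      = (LINT x:ball 0 R|lborel. R ^ p * k x - norm x ^ p * k x)"
    using set_int[of 0] set_int[of p] by (simp add: K_def)
  also have "\<dots> = (LINT x|lborel. LINT t|lborel. F x t)"
    by (simp add: inner_t set_lebesgue_integral_def)
  also have "\<dots> = (LINT t|lborel. LINT x|lborel. F x t)"
    by (rule lborel_pair.Fubini_integral[OF int, symmetric])
  \<comment> \<open>For \<open>p = 0\<close> the truncated exponents \<open>p - 1 + D\<close> and
    \<open>p + D - 1\<close> differ, but the factor \<open>real p\<close> makes both sides
    vanish.\<close>
  also have "\<dots> = K / R ^ D * (real p / real (p + D)) * (LINT t|lborel. real (p + D) * t ^ (p + D - 1) * indicator {0..R} t)"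
    using D by (cases "p = 0") (simp_all add: inner_x mult.assoc flip: integral_mult_right_zero)
  also have "(LINT t|lborel. real (p + D) * t ^ (p + D - 1) * indicator {0..R} t) = R ^ (p + D) - 0 ^ (p + D)"
    using \<open>R > 0\<close> by (intro integral_FTC_Icc_real) (auto intro!: derivative_eq_intros)
  finally have "(LINT x:ball 0 R|lborel. norm x ^ p * k x) = R ^ p * K - K / R ^ D * (real p / real (p + D)) * R ^ (p + D)"
    using D by (simp add: zero_power algebra_simps)
  also have "K / R ^ D * (real p / real (p + D)) * R ^ (p + D) = R ^ p * K * (real p / real (p + D))"
    using \<open>R > 0\<close> by (simp add: power_add)
  also have "R ^ p * K - R ^ p * K * (real p / real (p + D)) = R ^ p * K * (1 - real p / real (p + D))"
    by (simp only: right_diff_distrib mult_1_right)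
  also have "1 - real p / real (p + D) = real D / real (D + p)"
    using D by (simp add: field_simps)
  finally show ?thesis by (simp add: D_def K_def mult_ac)
qed

section \<open>Lipschitz bounds for products and powers on compact sets\<close>

lemma lipschitz_on_compact_mult:
  fixes f g :: "'a::metric_space \<Rightarrow> real"
  assumes "compact S" "L-lipschitz_on S f" "M-lipschitz_on S g"
  shows "\<exists>K. K-lipschitz_on S (\<lambda>x. f x * g x)"
proof -
  have "bounded (f ` S)" "bounded (g ` S)"
    using assms by (auto intro!: compact_imp_bounded compact_continuous_image lipschitz_on_continuous_on)
  then obtain A B where A: "\<And>x. x \<in> S \<Longrightarrow> \<bar>f x\<bar> \<le> A" and B: "\<And>x. x \<in> S \<Longrightarrow> \<bar>g x\<bar> \<le> B"
    by (auto simp: bounded_iff)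
  have LM: "0 \<le> L" "0 \<le> M"
    using assms by (auto dest: lipschitz_on_nonneg)
  \<comment> \<open>The absolute values keep the constant nonnegative even if \<open>S\<close> is
    empty and \<open>A\<close>, \<open>B\<close> are arbitrary.\<close>
  have "(\<bar>A\<bar> * M + \<bar>B\<bar> * L)-lipschitz_on S (\<lambda>x. f x * g x)"
  proof (rule lipschitz_onI)
    fix x y assume xy: "x \<in> S" "y \<in> S"
    have "dist (f x * g x) (f y * g y) = \<bar>f x * (g x - g y) + g y * (f x - f y)\<bar>"
      by (simp add: dist_real_def algebra_simps)
    also have "\<dots> \<le> \<bar>f x\<bar> * dist (g x) (g y) + \<bar>g y\<bar> * dist (f x) (f y)"
      by (simp add: dist_real_def flip: abs_mult)
    also have "\<dots> \<le> \<bar>A\<bar> * (M * dist x y) + \<bar>B\<bar> * (L * dist x y)"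
      using A[OF xy(1)] B[OF xy(2)] xy assms LM
      by (intro add_mono mult_mono lipschitz_onD[of M S g] lipschitz_onD[of L S f]) auto
    finally show "dist (f x * g x) (f y * g y) \<le> (\<bar>A\<bar> * M + \<bar>B\<bar> * L) * dist x y"
      by (simp add: algebra_simps)
  qed (use LM in auto)
  then show ?thesis ..
qed

lemma lipschitz_on_compact_power:
  fixes f :: "'a::metric_space \<Rightarrow> real"
  assumes "compact S" "L-lipschitz_on S f"
  shows "\<exists>K. K-lipschitz_on S (\<lambda>x. f x ^ m)"
proof (induction m)
  case 0
  then show ?case using lipschitz_on_constant[of S 1] by auto
next
  case (Suc m)
  then show ?case using lipschitz_on_compact_mult[OF assms] by auto
qed

lemma lipschitz_on_inner: "(norm v)-lipschitz_on S (\<lambda>x. x \<bullet> v)"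
proof (rule lipschitz_onI)
  show "dist (x \<bullet> v) (y \<bullet> v) \<le> norm v * dist x y" for x y
    using Cauchy_Schwarz_ineq2[of "x - y" v]
    by (simp add: dist_norm inner_diff_left mult.commute)
qed simp

lemma lipschitz_on_norm: "1-lipschitz_on S norm"
  by (rule lipschitz_onI) (auto simp: dist_norm norm_triangle_ineq3)

section \<open>Cone extension of boundary values and concentration on the sphere\<close>

lemma set_integrable_lborel_ball:
  fixes f :: "'a::euclidean_space \<Rightarrow> real"
  assumes "continuous_on (cball 0 R) f"
  shows "set_integrable lborel (ball 0 R) f"
proof -
  have "set_integrable lborel (cball 0 R) f"
    unfolding set_integrable_def using assms by (intro borel_integrable_compact) auto
  then show ?thesis by (rule set_integrable_subset) auto
qed

text \<open>Since \<open>R / 0 = 0\<close>, the value at the origin is \<open>h 0\<close>; the origin is a null set.\<close>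

definition cone_extension :: "real \<Rightarrow> ('a::real_normed_vector \<Rightarrow> real) \<Rightarrow> 'a \<Rightarrow> real" where
  "cone_extension R h x = h ((R / norm x) *\<^sub>R x)"

lemma cone_extension_homogeneous:
  "c > 0 \<Longrightarrow> cone_extension R h (c *\<^sub>R x) = cone_extension R h x"
  by (simp add: cone_extension_def)

text \<open>Only the values of \<open>h\<close> on the closed ball are controlled, so
  \<open>h\<close> is cut off there before composing; the radial map takes all its values in that
  ball.\<close>

lemma borel_measurable_cone_extension:
  fixes h :: "'a::euclidean_space \<Rightarrow> real"
  assumes "R > 0" "continuous_on (cball 0 R) h"
  shows "cone_extension R h \<in> borel_measurable borel"
proof -
  have [measurable]: "(\<lambda>x. indicator (cball 0 R) x *\<^sub>R h x) \<in> borel_measurable borel"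
    using assms by (intro borel_measurable_continuous_on_indicator) auto
  have "cone_extension R h = (\<lambda>x. indicator (cball 0 R) ((R / norm x) *\<^sub>R x) *\<^sub>R h ((R / norm x) *\<^sub>R x))"
    using assms by (simp add: cone_extension_def fun_eq_iff)
  also have "\<dots> \<in> borel_measurable borel"
    by (rule measurable_compose[where g = "\<lambda>x. indicator (cball 0 R) x *\<^sub>R h x"]) measurable
  finally show ?thesis .
qed

lemma cone_extension_bounded:
  fixes h :: "'a::euclidean_space \<Rightarrow> real"
  assumes "R > 0" "continuous_on (cball 0 R) h"
  shows "\<exists>B. \<forall>x. \<bar>cone_extension R h x\<bar> \<le> B"
proof -
  have "bounded (h ` cball 0 R)"
    using assms by (intro compact_imp_bounded compact_continuous_image) auto
  then obtain B where "\<And>x. x \<in> cball 0 R \<Longrightarrow> \<bar>h x\<bar> \<le> B"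
    unfolding bounded_iff by (metis imageI real_norm_def)
  moreover have "(R / norm x) *\<^sub>R x \<in> cball 0 R" for x :: 'a
    using \<open>R > 0\<close> by simp
  ultimately show ?thesis
    unfolding cone_extension_def by blast
qed

text \<open>The cone extension can be discontinuous at the origin, so integrability comes from
  boundedness and measurability.\<close>

lemma set_integrable_norm_power_cone_extension:
  fixes h :: "'a::euclidean_space \<Rightarrow> real"
  assumes "R > 0" "continuous_on (cball 0 R) h"
  shows "set_integrable lborel (ball 0 R) (\<lambda>x. norm x ^ p * cone_extension R h x)"
proof -
  note borel_measurable_cone_extension[OF assms, measurable]
  have [measurable]: "ball 0 R \<in> sets (borel :: 'a measure)"
    by simp
  obtain B where B: "\<And>x. \<bar>cone_extension R h x\<bar> \<le> B"
    using cone_extension_bounded[OF assms] by blast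
  show ?thesis
    unfolding set_integrable_def
  proof (rule integrableI_bounded_set[where A = "ball 0 R" and B = "R ^ p * B"])
    show "emeasure lborel (ball (0::'a) R) < \<infinity>" by (rule emeasure_lborel_ball_finite)
    show "AE x in lborel. x \<in> ball 0 R \<longrightarrow>
        norm (indicat_real (ball 0 R) x *\<^sub>R (norm x ^ p * cone_extension R h x)) \<le> R ^ p * B"
      using B \<open>R > 0\<close> by (intro AE_I2) (auto simp: abs_mult intro!: mult_mono power_mono)
    show "(\<lambda>x. indicat_real (ball 0 R) x *\<^sub>R (norm x ^ p * cone_extension R h x)) \<in> borel_measurable lborel"
      by measurable
  qed (auto simp: indicator_def)
qed

text \<open>A Lipschitz function differs from its boundary value on the same ray by at most \<open>K (R - |x|)\<close>,
  so the error of replacing \<open>h\<close> by its cone extension is an explicit difference of two moments.\<close>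

lemma concentration_on_sphere:
  fixes h :: "'a::euclidean_space \<Rightarrow> real"
  assumes "R > 0" and lip: "K-lipschitz_on (cball 0 R) h"
  shows "(\<lambda>m. real (2 * m + 2) / R ^ (2 * m + 2) * (LINT x:ball 0 R|lborel. norm x ^ (2 * m) * h x))
    \<longlonglongrightarrow> real DIM('a) / R\<^sup>2 * (LINT x:ball 0 R|lborel. cone_extension R h x)"
proof -
  let ?B = "ball (0::'a) R"
  define D where "D = DIM('a)"
  define k where "k = cone_extension R h"
  \<comment> \<open>This factor comes from the gradient of the cutoff: the derivative of
    \<open>norm x ^ (2 * m + 2) / R ^ (2 * m + 2)\<close> along \<open>v\<close> is
    \<open>a m * norm x ^ (2 * m) * (x \<bullet> v)\<close>.\<close>
  define a where "a m = real (2 * m + 2) / R ^ (2 * m + 2)" for m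
  define V where "V = (LINT x:?B|lborel. 1::real)"
  have a: "0 \<le> a m" for m using \<open>R > 0\<close> by (simp add: a_def)
  have K: "0 \<le> K" using lip by (rule lipschitz_on_nonneg)
  have h: "continuous_on (cball 0 R) h"
    using lip by (rule lipschitz_on_continuous_on)
  have k_meas: "k \<in> borel_measurable borel"
    unfolding k_def using \<open>R > 0\<close> h by (rule borel_measurable_cone_extension)
  have k_hom: "k (c *\<^sub>R x) = k x" if "c > 0" for c x
    using that by (simp add: k_def cone_extension_homogeneous)
  obtain B where kB: "\<And>x. \<bar>k x\<bar> \<le> B"
    unfolding k_def using cone_extension_bounded[OF \<open>R > 0\<close> h] by blast
  have int_k: "(LINT x:?B|lborel. norm x ^ p * k x) = real D / real (D + p) * R ^ p * (LINT x:?B|lborel. k x)" for p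
    unfolding D_def by (rule integral_norm_power_homogeneous[OF \<open>R > 0\<close> k_meas kB k_hom])
  have int_1: "(LINT x:?B|lborel. norm x ^ p) = real D / real (D + p) * R ^ p * V" for p
    using integral_norm_power_homogeneous[OF \<open>R > 0\<close>, of "\<lambda>_::'a. 1" 1 p] by (simp add: D_def V_def)
  have dist_hk: "\<bar>h x - k x\<bar> \<le> K * (R - norm x)" if x: "x \<in> ?B" for x
  proof (cases "x = 0")
    case True
    then show ?thesis using K \<open>R > 0\<close> by (simp add: k_def cone_extension_def)
  next
    case False
    have "x - (R / norm x) *\<^sub>R x = (1 - R / norm x) *\<^sub>R x"
      by (simp add: algebra_simps)
    then have "norm (x - (R / norm x) *\<^sub>R x) = \<bar>(1 - R / norm x) * norm x\<bar>"
      by (simp add: abs_mult)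
    also have "\<dots> = R - norm x"
      using x False by (simp add: left_diff_distrib)
    finally show ?thesis
      using lipschitz_on_normD[OF lip, of x "(R / norm x) *\<^sub>R x"] x \<open>R > 0\<close>
      by (simp add: k_def cone_extension_def)
  qed
  have si_h: "set_integrable lborel ?B (\<lambda>x. norm x ^ p * h x)" for p
    using h by (intro set_integrable_lborel_ball continuous_intros)
  have si_k: "set_integrable lborel ?B (\<lambda>x. norm x ^ p * k x)" for p
    unfolding k_def using \<open>R > 0\<close> h by (rule set_integrable_norm_power_cone_extension)
  have si_n: "set_integrable lborel ?B (\<lambda>x. norm x ^ p)" for p
    by (intro set_integrable_lborel_ball continuous_intros)
  have err: "\<bar>(LINT x:?B|lborel. norm x ^ p * h x) - (LINT x:?B|lborel. norm x ^ p * k x)\<bar>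
      \<le> K * (real D * R ^ (p + 1) * V * (1 / real (D + p) - 1 / real (D + p + 1)))" for p
  proof -
    have "\<bar>LINT x:?B|lborel. norm x ^ p * h x - norm x ^ p * k x\<bar>
        \<le> (LINT x:?B|lborel. \<bar>norm x ^ p * h x - norm x ^ p * k x\<bar>)"
      using set_integral_norm_bound[OF set_integral_diff(1)[OF si_h si_k]] by simp
    also have "\<dots> \<le> (LINT x:?B|lborel. K * (R * norm x ^ p - norm x ^ (p + 1)))"
    proof (rule set_integral_mono)
      show "set_integrable lborel ?B (\<lambda>x. \<bar>norm x ^ p * h x - norm x ^ p * k x\<bar>)"
        by (intro set_integrable_abs set_integral_diff(1) si_h si_k)
      show "set_integrable lborel ?B (\<lambda>x. K * (R * norm x ^ p - norm x ^ (p + 1)))"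
        by (intro set_integrable_lborel_ball continuous_intros)
      fix x assume "x \<in> ?B"
      have "\<bar>norm x ^ p * h x - norm x ^ p * k x\<bar> = norm x ^ p * \<bar>h x - k x\<bar>"
        by (simp add: abs_mult flip: right_diff_distrib)
      also have "\<dots> \<le> norm x ^ p * (K * (R - norm x))"
        using \<open>x \<in> ?B\<close> by (intro mult_left_mono dist_hk) auto
      finally show "\<bar>norm x ^ p * h x - norm x ^ p * k x\<bar> \<le> K * (R * norm x ^ p - norm x ^ (p + 1))"
        by (simp add: algebra_simps)
    qed
    also have "\<dots> = K * (R * (LINT x:?B|lborel. norm x ^ p) - (LINT x:?B|lborel. norm x ^ (p + 1)))"
      using si_n[of p] si_n[of "p + 1"] by simp
    also have "\<dots> = K * (real D * R ^ (p + 1) * V * (1 / real (D + p) - 1 / real (D + p + 1)))"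
      by (simp only: int_1) (simp add: algebra_simps)
    finally show ?thesis
      using si_h si_k by simp
  qed
  have "(\<lambda>m. a m * (LINT x:?B|lborel. norm x ^ (2 * m) * h x) - a m * (LINT x:?B|lborel. norm x ^ (2 * m) * k x)) \<longlonglongrightarrow> 0"
  proof (rule Lim_null_comparison)
    show "eventually (\<lambda>m. norm (a m * (LINT x:?B|lborel. norm x ^ (2 * m) * h x) - a m * (LINT x:?B|lborel. norm x ^ (2 * m) * k x))
        \<le> K * real D * V / R * (real (2 * m + 2) * (1 / real (D + 2 * m) - 1 / real (D + 2 * m + 1)))) sequentially"
    proof (rule always_eventually, rule allI)
      fix m
      have "norm (a m * (LINT x:?B|lborel. norm x ^ (2 * m) * h x) - a m * (LINT x:?B|lborel. norm x ^ (2 * m) * k x))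
        \<le> a m * (K * (real D * R ^ (2 * m + 1) * V * (1 / real (D + 2 * m) - 1 / real (D + 2 * m + 1))))"
        using mult_left_mono[OF err[of "2 * m"] a[of m]] a[of m]
        by (simp add: abs_mult flip: right_diff_distrib)
      also have "\<dots> = K * real D * V / R * (real (2 * m + 2) * (1 / real (D + 2 * m) - 1 / real (D + 2 * m + 1)))"
        using \<open>R > 0\<close> by (simp add: a_def)
      finally show "norm (a m * (LINT x:?B|lborel. norm x ^ (2 * m) * h x) - a m * (LINT x:?B|lborel. norm x ^ (2 * m) * k x))
        \<le> K * real D * V / R * (real (2 * m + 2) * (1 / real (D + 2 * m) - 1 / real (D + 2 * m + 1)))" .
    qed
    \<comment> \<open>The difference of reciprocals is of order \<open>1 / m\<^sup>2\<close>, which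
      beats the linear factor.\<close>
    have "(\<lambda>m. real (2 * m + 2) * (1 / (real D + real (2 * m)) - 1 / (real D + real (2 * m) + 1))) \<longlonglongrightarrow> 0"
      by real_asymp
    then have "(\<lambda>m. K * real D * V / R * (real (2 * m + 2) * (1 / real (D + 2 * m) - 1 / real (D + 2 * m + 1)))) \<longlonglongrightarrow> K * real D * V / R * 0"
      by (intro tendsto_mult_left) (simp add: add_ac)
    then show "(\<lambda>m. K * real D * V / R * (real (2 * m + 2) * (1 / real (D + 2 * m) - 1 / real (D + 2 * m + 1)))) \<longlonglongrightarrow> 0"
      by simp
  qed
  \<comment> \<open>With \<open>p = 2 * m\<close> in \<open>int_k\<close>, the powers of
    \<open>R\<close> cancel down to \<open>1 / R\<^sup>2\<close>, and the ratio of
    \<open>2 * m + 2\<close> to \<open>D + 2 * m\<close> tends to 1.\<close>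
  moreover have "(\<lambda>m. a m * (LINT x:?B|lborel. norm x ^ (2 * m) * k x)) \<longlonglongrightarrow> real D / R\<^sup>2 * (LINT x:?B|lborel. k x)"
  proof -
    have "(\<lambda>m. real (2 * m + 2) / (real D + real (2 * m))) \<longlonglongrightarrow> 1"
      by real_asymp
    then have "(\<lambda>m. real (2 * m + 2) / (real D + real (2 * m)) * (real D / R\<^sup>2 * (LINT x:?B|lborel. k x)))
        \<longlonglongrightarrow> 1 * (real D / R\<^sup>2 * (LINT x:?B|lborel. k x))"
      by (intro tendsto_mult_right)
    also have "(\<lambda>m. real (2 * m + 2) / (real D + real (2 * m)) * (real D / R\<^sup>2 * (LINT x:?B|lborel. k x)))
        = (\<lambda>m. a m * (LINT x:?B|lborel. norm x ^ (2 * m) * k x))"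
    proof
      show "real (2 * m + 2) / (real D + real (2 * m)) * (real D / R\<^sup>2 * (LINT x:?B|lborel. k x))
          = a m * (LINT x:?B|lborel. norm x ^ (2 * m) * k x)" for m
        using \<open>R > 0\<close> by (simp only: int_k a_def power_add) simp
    qed
    finally show ?thesis by simp
  qed
  ultimately have "(\<lambda>m. a m * (LINT x:?B|lborel. norm x ^ (2 * m) * h x)) \<longlonglongrightarrow> 0 + real D / R\<^sup>2 * (LINT x:?B|lborel. k x)"
    using tendsto_add by fastforce
  then show ?thesis
    by (simp add: a_def D_def k_def)
qed

section \<open>The divergence theorem on the ball\<close>

text \<open>The product rule splits the vanishing integral for the cutoff times \<open>f\<close>
  into a part tending to the left side and a part that concentrates on the sphere. On the right,
  \<open>DIM('a) / R\<close> normalizes the cone measure, and the other \<open>1 / R\<close> turns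
  \<open>x \<bullet> v\<close> into the normal component of \<open>v\<close>.\<close>

lemma integral_directional_derivative_ball:
  fixes f :: "'a::euclidean_space \<Rightarrow> real"
  assumes "R > 0" and lip: "L-lipschitz_on (cball 0 R) f"
    and der: "\<And>x. x \<in> ball 0 R \<Longrightarrow> (f has_derivative f' x) (at x)"
    and int: "set_integrable lborel (ball 0 R) (\<lambda>x. f' x v)"
  shows "(LINT x:ball 0 R|lborel. f' x v)
    = real DIM('a) / R\<^sup>2 * (LINT x:ball 0 R|lborel. cone_extension R (\<lambda>x. (x \<bullet> v) * f x) x)"
proof -
  let ?B = "ball (0::'a) R"
  define h where "h x = (x \<bullet> v) * f x" for x
  obtain K where K: "K-lipschitz_on (cball 0 R) h"
    unfolding h_def using lipschitz_on_compact_mult[OF _ lipschitz_on_inner lip] by auto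
  have h: "continuous_on (cball 0 R) h"
    using K by (rule lipschitz_on_continuous_on)
  \<comment> \<open>The even exponent makes the cutoff a polynomial in \<open>x \<bullet> x\<close>,
    hence differentiable at the origin too.\<close>
  define c where "c m x = 1 - norm x ^ (2 * m + 2) / R ^ (2 * m + 2)" for m and x :: 'a
  define w where "w m x = real (2 * m + 2) / R ^ (2 * m + 2) * (norm x ^ (2 * m) * h x)" for m x
  have c: "0 \<le> c m x" "c m x \<le> 1" if "x \<in> ?B" for m x
    using that \<open>R > 0\<close> power_mono[of "norm x" R "2 * m + 2"]
    by (auto simp: c_def divide_le_eq simp del: power_Suc)
  have si_c: "set_integrable lborel ?B (\<lambda>x. c m x * f' x v)" for m
    unfolding set_integrable_def
  proof (rule Bochner_Integration.integrable_bound)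
    show "integrable lborel (\<lambda>x. indicator ?B x *\<^sub>R f' x v)"
      using int by (simp add: set_integrable_def)
    then have [measurable]: "(\<lambda>x. indicator ?B x *\<^sub>R f' x v) \<in> borel_measurable lborel"
      by (rule borel_measurable_integrable)
    have "(\<lambda>x. c m x * (indicator ?B x *\<^sub>R f' x v)) \<in> borel_measurable lborel"
      unfolding c_def by measurable
    then show "(\<lambda>x. indicator ?B x *\<^sub>R (c m x * f' x v)) \<in> borel_measurable lborel"
      by (simp add: mult_ac)
    show "AE x in lborel. norm (indicator ?B x *\<^sub>R (c m x * f' x v)) \<le> norm (indicator ?B x *\<^sub>R f' x v)"
      using c by (intro AE_I2) (auto simp: indicator_def abs_mult intro!: mult_left_le_one_le)
  qed
  have si_w: "set_integrable lborel ?B (w m)" for m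
    unfolding w_def using h by (intro set_integrable_lborel_ball continuous_intros) auto
  have eq: "(LINT x:?B|lborel. c m x * f' x v) = (LINT x:?B|lborel. w m x)" for m
  proof -
    have "\<exists>M. M-lipschitz_on (cball 0 R) (\<lambda>x. c m x * f x)"
    proof -
      obtain M where "M-lipschitz_on (cball (0::'a) R) (\<lambda>x. norm x ^ (2 * m + 2))"
        using lipschitz_on_compact_power[OF compact_cball lipschitz_on_norm] by blast
      then have "(0 + \<bar>1 / R ^ (2 * m + 2)\<bar> * M)-lipschitz_on (cball (0::'a) R) (\<lambda>x. 1 - (1 / R ^ (2 * m + 2)) * norm x ^ (2 * m + 2))"
        by (intro lipschitz_intros)
      then show ?thesis
        by (intro lipschitz_on_compact_mult[OF compact_cball _ lip]) (simp add: c_def)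
    qed
    then obtain M where M: "M-lipschitz_on (cball 0 R) (\<lambda>x. c m x * f x)" ..
    \<comment> \<open>The product-rule derivative of \<open>c m x * f x\<close>; at
      \<open>u = v\<close> its subtracted term is \<open>w m x\<close>.\<close>
    define G' where "G' x u = c m x * f' x u
        - real (2 * m + 2) / R ^ (2 * m + 2) * (norm x ^ (2 * m) * ((x \<bullet> u) * f x))" for x u
    have "(LINT x:?B|lborel. G' x v) = 0"
    proof (rule integral_directional_derivative_ball_eq_0[OF \<open>R > 0\<close> M])
      show "c m x * f x = 0" if "norm x = R" for x
        using that \<open>R > 0\<close> by (simp add: c_def)
      show "((\<lambda>x. c m x * f x) has_derivative G' x) (at x)"
        if "x \<in> ?B" for x
      proof -
        have c_eq: "c m = (\<lambda>x. 1 - (x \<bullet> x) ^ (m + 1) / R ^ (2 * m + 2))"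
        proof
          show "c m x = 1 - (x \<bullet> x) ^ (m + 1) / R ^ (2 * m + 2)" for x
            using power_mult[of "norm x" 2 "m + 1"] by (simp add: c_def dot_square_norm)
        qed
        have n_eq: "norm x ^ (2 * m) = (x \<bullet> x) ^ m"
          by (simp add: dot_square_norm power_mult)
        have "((\<lambda>x. x \<bullet> x) has_derivative (\<lambda>u. 2 * (x \<bullet> u))) (at x)"
          by (auto intro!: derivative_eq_intros simp: inner_commute)
        from has_derivative_power[OF this, of "m + 1"]
        have "((\<lambda>x. (x \<bullet> x) ^ (m + 1)) has_derivative (\<lambda>u. real (m + 1) * (2 * (x \<bullet> u)) * (x \<bullet> x) ^ m)) (at x)"
          by (simp only: add_diff_cancel_right')
        then have "((\<lambda>x. (1 - (x \<bullet> x) ^ (m + 1) / R ^ (2 * m + 2)) * f x) has_derivative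
            (\<lambda>u. (1 - (x \<bullet> x) ^ (m + 1) / R ^ (2 * m + 2)) * f' x u
              + (0 - real (m + 1) * (2 * (x \<bullet> u)) * (x \<bullet> x) ^ m / R ^ (2 * m + 2)) * f x)) (at x)"
          by (intro has_derivative_mult has_derivative_diff has_derivative_const bounded_linear.has_derivative[OF bounded_linear_divide] der[OF that])
        then show ?thesis
          unfolding G'_def n_eq c_eq by (rule has_derivative_eq_rhs) (simp add: fun_eq_iff algebra_simps)
      qed
    qed
    then show ?thesis
      using set_integral_diff(2)[OF si_c[of m] si_w[of m]]
      by (simp only: G'_def w_def[symmetric] h_def[symmetric])
  qed
  have "(\<lambda>m. LINT x:?B|lborel. c m x * f' x v) \<longlonglongrightarrow> (LINT x:?B|lborel. f' x v)"
    unfolding set_lebesgue_integral_def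
  proof (rule integral_dominated_convergence)
    show "integrable lborel (\<lambda>x. norm (indicator ?B x *\<^sub>R f' x v))"
      using int by (simp add: set_integrable_def)
    show "(\<lambda>x. indicator ?B x *\<^sub>R f' x v) \<in> borel_measurable lborel"
      using int unfolding set_integrable_def by (rule borel_measurable_integrable)
    show "(\<lambda>x. indicator ?B x *\<^sub>R (c m x * f' x v)) \<in> borel_measurable lborel" for m
      using si_c[of m] unfolding set_integrable_def by (rule borel_measurable_integrable)
    show "AE x in lborel. norm (indicator ?B x *\<^sub>R (c m x * f' x v)) \<le> norm (indicator ?B x *\<^sub>R f' x v)" for m
      using c by (intro AE_I2) (auto simp: indicator_def abs_mult intro!: mult_left_le_one_le)
    show "AE x in lborel. (\<lambda>m. indicator ?B x *\<^sub>R (c m x * f' x v)) \<longlonglongrightarrow> indicator ?B x *\<^sub>R f' x v"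
    proof (rule AE_I2)
      fix x :: 'a
      show "(\<lambda>m. indicator ?B x *\<^sub>R (c m x * f' x v)) \<longlonglongrightarrow> indicator ?B x *\<^sub>R f' x v"
      proof (cases "x \<in> ?B")
        case True
        \<comment> \<open>Strictly inside the ball the ratio is below 1, so the cutoff tends to 1
          pointwise.\<close>
        then have "(norm x / R)\<^sup>2 < 1"
          using \<open>R > 0\<close> by (auto intro!: power_less_one_iff[THEN iffD2] simp: abs_square_less_1)
        then have "(\<lambda>m. ((norm x / R)\<^sup>2) ^ Suc m) \<longlonglongrightarrow> 0"
          by (intro LIMSEQ_Suc LIMSEQ_realpow_zero) auto
        also have "(\<lambda>m. ((norm x / R)\<^sup>2) ^ Suc m) = (\<lambda>m. norm x ^ (2 * m + 2) / R ^ (2 * m + 2))"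
          by (simp only: power_divide flip: power_mult) simp
        finally have "(\<lambda>m. c m x * f' x v) \<longlonglongrightarrow> (1 - 0) * f' x v"
          unfolding c_def by (intro tendsto_intros)
        then show ?thesis using True by simp
      qed simp
    qed
  qed
  moreover have "(\<lambda>m. LINT x:?B|lborel. c m x * f' x v)
      \<longlonglongrightarrow> real DIM('a) / R\<^sup>2 * (LINT x:?B|lborel. cone_extension R h x)"
    using concentration_on_sphere[OF \<open>R > 0\<close> K] by (simp add: eq w_def)
  ultimately show ?thesis
    using LIMSEQ_unique unfolding h_def by blast
qed

section \<open>Sphere integrals and the integral Cauchy--Schwarz inequality\<close>

lemma integral_scale_measure:
  fixes f :: "'a \<Rightarrow> real"
  assumes "0 \<le> c" "f \<in> borel_measurable M"
  shows "integral\<^sup>L (scale_measure (ennreal c) M) f = c * integral\<^sup>L M f"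
proof -
  have "scale_measure (ennreal c) M = density M (\<lambda>_. ennreal c)"
    by (rule measure_eqI) (simp_all add: emeasure_density_const)
  then show ?thesis
    using assms by (simp add: integral_density)
qed

text \<open>The push-forward formula for the radial map turns the sphere integral into a ball
  integral. Cutting \<open>h\<close> off to the sphere first gives a function that is Borel on the
  whole space; the origin is a null set.\<close>

lemma integral_sphere_measure:
  fixes h :: "real ^ 'n::finite \<Rightarrow> real"
  assumes "R > 0" "continuous_on (cball 0 R) h"
  shows "(LINT x:sphere 0 R|sphere_measure R. h x)
    = real CARD('n) / R * (LINT x:ball 0 R|lborel. cone_extension R h x)"
proof -
  define g where "g x = indicator (sphere 0 R) x *\<^sub>R h x" for x
  let ?r = "\<lambda>x :: real ^ 'n. (R / norm x) *\<^sub>R x"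
  let ?M = "restrict_space lborel (ball 0 R - {0 :: real ^ 'n})"
  have [measurable]: "g \<in> borel_measurable borel"
    unfolding g_def using continuous_on_subset[OF assms(2)]
    by (intro borel_measurable_continuous_on_indicator) auto
  note borel_measurable_cone_extension[OF assms, measurable]
  have [measurable]: "ball 0 R \<in> sets (borel :: (real ^ 'n) measure)"
    by simp
  have g_radial: "g (?r x) = cone_extension R h x" if "x \<noteq> 0" for x
    using that \<open>R > 0\<close> by (simp add: g_def cone_extension_def)
  have "(LINT x:sphere 0 R|sphere_measure R. h x) = integral\<^sup>L (sphere_measure R) g"
    by (simp add: set_lebesgue_integral_def g_def[abs_def])
  also have "\<dots> = real CARD('n) / R * integral\<^sup>L (distr ?M borel ?r) g"
    unfolding sphere_measure_def using \<open>R > 0\<close> by (intro integral_scale_measure) auto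
  also have "integral\<^sup>L (distr ?M borel ?r) g = (LINT x|?M. g (?r x))"
    by (rule integral_distr[OF radial_measurable]) measurable
  also have "\<dots> = (LINT x|lborel. indicator (ball 0 R - {0}) x *\<^sub>R g (?r x))"
    by (rule integral_restrict_space) auto
  also have "\<dots> = (LINT x:ball 0 R|lborel. cone_extension R h x)"
    unfolding set_lebesgue_integral_def
    by (intro integral_cong_AE AE_mp[OF AE_lborel_singleton[of 0] AE_I2])
       (auto simp: g_radial indicator_def)
  finally show ?thesis .
qed

text \<open>The integral of \<open>(f x - t * g x)\<^sup>2\<close> is a nonnegative quadratic
  polynomial in \<open>t\<close>.\<close>

lemma set_integral_Cauchy_Schwarz:
  fixes f g :: "'a \<Rightarrow> real"
  assumes ff: "set_integrable M S (\<lambda>x. (f x)\<^sup>2)" and gg: "set_integrable M S (\<lambda>x. (g x)\<^sup>2)"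
    and fg: "set_integrable M S (\<lambda>x. f x * g x)"
  shows "(LINT x:S|M. f x * g x)\<^sup>2 \<le> (LINT x:S|M. (f x)\<^sup>2) * (LINT x:S|M. (g x)\<^sup>2)"
proof -
  define F G J where "F = (LINT x:S|M. (f x)\<^sup>2)" and "G = (LINT x:S|M. (g x)\<^sup>2)"
    and "J = (LINT x:S|M. f x * g x)"
  have quad: "0 \<le> F - 2 * t * J + t\<^sup>2 * G" for t
  proof -
    have "0 \<le> (LINT x:S|M. (f x)\<^sup>2 - 2 * t * (f x * g x) + t\<^sup>2 * (g x)\<^sup>2)"
    proof -
      have "(f x)\<^sup>2 - 2 * t * (f x * g x) + t\<^sup>2 * (g x)\<^sup>2 = (f x - t * g x)\<^sup>2" for x
        by (simp add: power2_diff power_mult_distrib)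
      then show ?thesis
        by (simp add: set_lebesgue_integral_def)
    qed
    also have "\<dots> = F - 2 * t * J + t\<^sup>2 * G"
      using ff gg fg by (simp add: F_def G_def J_def)
    finally show ?thesis .
  qed
  have "0 \<le> G"
    by (simp add: G_def set_lebesgue_integral_def)
  have "J\<^sup>2 \<le> F * G"
  proof (cases "G = 0")
    case True
    have "J = 0"
      \<comment> \<open>For \<open>G = 0\<close> the polynomial is affine, and at this
        \<open>t\<close> a nonzero \<open>J\<close> would give the value -1.\<close>
      using quad[of "(F + 1) / (2 * J)"] True by (cases "J = 0") auto
    then show ?thesis using True by simp
  next
    case False
    with \<open>0 \<le> G\<close> have "G > 0" by simp
    then show ?thesis
      \<comment> \<open>\<open>J / G\<close> is the minimizer of the quadratic.\<close>
      using mult_right_mono[OF quad[of "J / G"], of G]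
      by (simp add: power2_eq_square algebra_simps)
  qed
  then show ?thesis by (simp add: F_def G_def J_def)
qed

section \<open>Gradients and Lipschitz bounds for functions smooth up to the boundary\<close>

lemma frechet_derivative_eq_inner_gradient:
  fixes f :: "real ^ 'n::finite \<Rightarrow> real"
  assumes "f differentiable (at x)"
  shows "frechet_derivative f (at x) v = gradient f x \<bullet> v"
proof -
  let ?F = "frechet_derivative f (at x)"
  have "linear ?F"
    using assms by (rule linear_frechet_derivative)
  have "?F v = ?F (\<Sum>i\<in>UNIV. v $ i *\<^sub>R axis i 1)"
    by (simp add: basis_expansion flip: scalar_mult_eq_scaleR)
  also have "\<dots> = gradient f x \<bullet> v"
    using \<open>linear ?F\<close>
    by (simp add: linear_sum linear_cmul inner_vec_def gradient_def partial_deriv_def mult.commute)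
  finally show ?thesis .
qed

text \<open>The singleton lists supply continuous extensions of the first partial derivatives, which
  are assembled into one field \<open>g\<close>; the empty list supplies differentiability.\<close>

lemma smooth_up_to_boundary_gradient:
  fixes f :: "real ^ 'n::finite \<Rightarrow> real"
  assumes "smooth_up_to_boundary S f"
  obtains g where "continuous_on (closure S) g" "\<And>x. x \<in> S \<Longrightarrow> gradient f x = g x"
    "\<And>x. x \<in> S \<Longrightarrow> (f has_derivative (\<lambda>v. g x \<bullet> v)) (at x)"
proof -
  have ext: "\<exists>g. continuous_on (closure S) g \<and> (\<forall>x\<in>S. g x = partial_deriv i f x)" for i
  proof -
    have "\<exists>g. continuous_on (closure S) g \<and> (\<forall>x\<in>S. g x = iterated_partial [i] f x)"
      using assms unfolding smooth_up_to_boundary_def by blast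
    then show ?thesis by simp
  qed
  then obtain g where g: "\<And>i. continuous_on (closure S) (g i)" "\<And>i x. x \<in> S \<Longrightarrow> g i x = partial_deriv i f x"
    by metis
  have diff: "f differentiable (at x)" if "x \<in> S" for x
    using assms that unfolding smooth_up_to_boundary_def by (auto dest: spec[of _ "[]"])
  show thesis
  proof
    show "continuous_on (closure S) (\<lambda>x. \<chi> i. g i x)"
      using g by (intro continuous_intros)
    show eq: "gradient f x = (\<chi> i. g i x)" if "x \<in> S" for x
      using g(2)[OF that] by (simp add: gradient_def)
    show "(f has_derivative (\<lambda>v. (\<chi> i. g i x) \<bullet> v)) (at x)" if "x \<in> S" for x
      using frechet_derivative_works[THEN iffD1, OF diff[OF that]]
      by (rule has_derivative_eq_rhs)
         (simp add: fun_eq_iff frechet_derivative_eq_inner_gradient[OF diff[OF that]] eq[OF that])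
  qed
qed

text \<open>By compactness \<open>g\<close> is bounded, so the mean value inequality on the convex
  set \<open>S\<close> gives a Lipschitz constant, which passes to the closure by
  continuity.\<close>

lemma bounded_gradient_imp_lipschitz_on_closure:
  fixes f :: "'a::euclidean_space \<Rightarrow> real"
  assumes "convex S" "bounded S" "continuous_on (closure S) f" "continuous_on (closure S) g"
    and der: "\<And>x. x \<in> S \<Longrightarrow> (f has_derivative (\<lambda>v. g x \<bullet> v)) (at x)"
  shows "\<exists>L. L-lipschitz_on (closure S) f"
proof -
  have "bounded (g ` closure S)"
    using assms by (intro compact_imp_bounded compact_continuous_image) auto
  then obtain C where C: "\<And>x. x \<in> S \<Longrightarrow> norm (g x) \<le> C"
    unfolding bounded_iff using closure_subset by blast
  have "\<bar>C\<bar>-lipschitz_on S f"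
  proof (rule bounded_derivative_imp_lipschitz)
    show "(f has_derivative (\<lambda>v. g x \<bullet> v)) (at x within S)" if "x \<in> S" for x
      using der[OF that] by (rule has_derivative_at_withinI)
    show "onorm (\<lambda>v. g x \<bullet> v) \<le> \<bar>C\<bar>" if "x \<in> S" for x
    proof (rule onorm_le)
      show "norm (g x \<bullet> v) \<le> \<bar>C\<bar> * norm v" for v
      proof -
        have "\<bar>g x \<bullet> v\<bar> \<le> norm (g x) * norm v"
          by (rule Cauchy_Schwarz_ineq2)
        also have "\<dots> \<le> \<bar>C\<bar> * norm v"
          using C[OF that] by (intro mult_right_mono) auto
        finally show ?thesis by simp
      qed
    qed
  qed (use assms in auto)
  then show ?thesis
    using assms by (intro exI lipschitz_on_closure)
qed

section \<open>The weighted divergence identity and the final inequality\<close>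

text \<open>This is the divergence theorem for the field with single component
  \<open>x $ i * (f x)\<^sup>2\<close> along axis \<open>i\<close>. On the sphere, the factor
  \<open>x \<bullet> axis i 1\<close> supplies the second \<open>x $ i\<close>.\<close>

lemma integral_square_plus_radial_derivative:
  fixes f :: "real ^ 'n::finite \<Rightarrow> real"
  assumes "R > 0" and lip: "L-lipschitz_on (cball 0 R) f" and g: "continuous_on (cball 0 R) g"
    and der: "\<And>x. x \<in> ball 0 R \<Longrightarrow> (f has_derivative (\<lambda>v. g x \<bullet> v)) (at x)"
  shows "(LINT x:ball 0 R|lborel. (f x)\<^sup>2) + 2 * (LINT x:ball 0 R|lborel. f x * (x $ i * g x $ i))
    = 1 / R * (LINT x:sphere 0 R|sphere_measure R. (x $ i)\<^sup>2 * (f x)\<^sup>2)"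
proof -
  have f: "continuous_on (cball 0 R) f"
    using lip by (rule lipschitz_on_continuous_on)
  let ?f = "\<lambda>x. x $ i * (f x)\<^sup>2"
  define f' where "f' x v = v $ i * (f x)\<^sup>2 + x $ i * (2 * f x * (g x \<bullet> v))" for x v
  have f'_axis: "f' x (axis i 1) = (f x)\<^sup>2 + 2 * (f x * (x $ i * g x $ i))" for x
    by (simp add: f'_def inner_axis)
  have sq: "set_integrable lborel (ball 0 R) (\<lambda>x. (f x)\<^sup>2)"
    using f by (intro set_integrable_lborel_ball continuous_intros)
  have rad: "set_integrable lborel (ball 0 R) (\<lambda>x. 2 * (f x * (x $ i * g x $ i)))"
    using f g by (intro set_integrable_lborel_ball continuous_intros)
  obtain M where M: "M-lipschitz_on (cball 0 R) ?f"
  proof -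
    obtain K where "K-lipschitz_on (cball 0 R) (\<lambda>x. (f x)\<^sup>2)"
      using lipschitz_on_compact_power[OF compact_cball lip] by blast
    moreover have "1-lipschitz_on (cball 0 R) (\<lambda>x :: real ^ 'n. x $ i)"
      using lipschitz_on_inner[of "axis i 1 :: real ^ 'n" "cball 0 R"] by (simp add: inner_axis norm_axis_1)
    ultimately show thesis
      using lipschitz_on_compact_mult[OF compact_cball] that by blast
  qed
  have "(LINT x:ball 0 R|lborel. f' x (axis i 1))
      = real CARD('n) / R\<^sup>2 * (LINT x:ball 0 R|lborel. cone_extension R (\<lambda>x. (x \<bullet> axis i 1) * ?f x) x)"
  proof (subst integral_directional_derivative_ball[OF \<open>R > 0\<close> M])
    show "(?f has_derivative f' x) (at x)" if "x \<in> ball 0 R" for x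
      unfolding f'_def[abs_def] using der[OF that]
      by (auto intro!: derivative_eq_intros bounded_linear_imp_has_derivative bounded_linear_vec_nth)
    show "set_integrable lborel (ball 0 R) (\<lambda>x. f' x (axis i 1))"
      unfolding f'_axis by (intro set_integral_add(1) sq rad)
  qed simp
  also have "\<dots> = 1 / R * (LINT x:sphere 0 R|sphere_measure R. (x $ i)\<^sup>2 * (f x)\<^sup>2)"
    using \<open>R > 0\<close> f
    by (subst integral_sphere_measure)
       (auto simp: inner_axis power2_eq_square mult.assoc intro!: continuous_intros)
  finally show ?thesis
    using sq rad by (simp add: f'_axis)
qed

theorem corollary2p20:
  fixes R :: real and n :: nat and e :: "nat \<Rightarrow> 'n::finite" and \<phi> :: "real^'n \<Rightarrow> real"
  assumes "n = CARD('n)" and "n \<ge> 2" and "R > 0"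
    and "bij_betw e {1..n} (UNIV :: 'n set)"
    and "smooth_up_to_boundary (ball 0 R) \<phi>"
  shows "let A = (2 * (LINT x:ball 0 R|lborel. \<bar>\<phi> x\<bar>\<^sup>2)
            - 1 / R * (LINT x:sphere 0 R|sphere_measure R.
                ((x $ e (n - 1))\<^sup>2 + (x $ e n)\<^sup>2) * \<bar>\<phi> x\<bar>\<^sup>2))\<^sup>2
     in (LINT x:ball 0 R|lborel. (norm (gradient \<phi> x))\<^sup>2)
          * (LINT x:ball 0 R|lborel. ((x $ e (n - 1))\<^sup>2 + (x $ e n)\<^sup>2) * \<bar>\<phi> x\<bar>\<^sup>2)
        \<ge> A / 4"
proof -
  define a b where "a = e (n - 1)" and "b = e n"
  let ?B = "ball (0 :: real ^ 'n) R"
  have "a \<noteq> b"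
  proof
    assume "a = b"
    \<comment> \<open>\<open>n \<ge> 2\<close> puts \<open>n - 1\<close> in the index range, so
      injectivity of \<open>e\<close> separates the two coordinates.\<close>
    moreover have "inj_on e {1..n}" "n - 1 \<in> {1..n}" "n \<in> {1..n}" "n - 1 \<noteq> n"
      using assms(2,4) by (auto simp: bij_betw_def)
    ultimately show False
      unfolding a_def b_def by (blast dest: inj_onD)
  qed
  have cl: "closure ?B = cball 0 R"
    using \<open>R > 0\<close> by simp
  have \<phi>: "continuous_on (cball 0 R) \<phi>"
    using assms(5) by (simp add: smooth_up_to_boundary_def cl)
  obtain g where g: "continuous_on (cball 0 R) g" "\<And>x. x \<in> ?B \<Longrightarrow> gradient \<phi> x = g x"
      "\<And>x. x \<in> ?B \<Longrightarrow> (\<phi> has_derivative (\<lambda>v. g x \<bullet> v)) (at x)"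
    using smooth_up_to_boundary_gradient[OF assms(5)] unfolding cl by metis
  obtain L where L: "L-lipschitz_on (cball 0 R) \<phi>"
    using bounded_gradient_imp_lipschitz_on_closure[of ?B \<phi> g] \<phi> g unfolding cl by auto
  define V where "V x = x $ a *\<^sub>R axis a (1::real) + x $ b *\<^sub>R axis b (1::real)" for x :: "real ^ 'n"
  have norm_V: "(norm (V x))\<^sup>2 = (x $ a)\<^sup>2 + (x $ b)\<^sup>2" for x
    using \<open>a \<noteq> b\<close>
    unfolding V_def power2_norm_eq_inner
    by (simp add: inner_add_left inner_add_right inner_axis_axis power2_eq_square)
  have V: "continuous_on S V" for S
    unfolding V_def by (intro continuous_intros)
  have V_g: "V x \<bullet> g x = x $ a * g x $ a + x $ b * g x $ b" for x
    by (simp add: V_def inner_add_left inner_axis')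
  define P where "P = (LINT x:?B|lborel. (\<phi> x)\<^sup>2)"
  define J where "J = (LINT x:?B|lborel. \<phi> x * (V x \<bullet> g x))"
  \<comment> \<open>Additivity is proved after passing to cone extensions, whose integrability on
    the ball is already known.\<close>
  have sphere_split: "(LINT x:sphere 0 R|sphere_measure R. ((x $ a)\<^sup>2 + (x $ b)\<^sup>2) * (\<phi> x)\<^sup>2)
      = (LINT x:sphere 0 R|sphere_measure R. (x $ a)\<^sup>2 * (\<phi> x)\<^sup>2)
        + (LINT x:sphere 0 R|sphere_measure R. (x $ b)\<^sup>2 * (\<phi> x)\<^sup>2)"
  proof -
    have c: "continuous_on (cball 0 R) (\<lambda>x. (x $ i)\<^sup>2 * (\<phi> x)\<^sup>2)" for i
      using \<phi> by (intro continuous_intros)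
    have "set_integrable lborel ?B (cone_extension R (\<lambda>x. (x $ i)\<^sup>2 * (\<phi> x)\<^sup>2))" for i
      using set_integrable_norm_power_cone_extension[OF \<open>R > 0\<close> c, of 0] by simp
    moreover have "cone_extension R (\<lambda>x. (x $ a)\<^sup>2 * (\<phi> x)\<^sup>2 + (x $ b)\<^sup>2 * (\<phi> x)\<^sup>2)
        = (\<lambda>x. cone_extension R (\<lambda>x. (x $ a)\<^sup>2 * (\<phi> x)\<^sup>2) x + cone_extension R (\<lambda>x. (x $ b)\<^sup>2 * (\<phi> x)\<^sup>2) x)"
      by (simp add: cone_extension_def fun_eq_iff)
    ultimately show ?thesis
      unfolding distrib_right
      by (simp add: integral_sphere_measure[OF \<open>R > 0\<close>] c continuous_on_add distrib_left)
  qed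
  have J_split: "J = (LINT x:?B|lborel. \<phi> x * (x $ a * g x $ a)) + (LINT x:?B|lborel. \<phi> x * (x $ b * g x $ b))"
  proof -
    have "set_integrable lborel ?B (\<lambda>x. \<phi> x * (x $ i * g x $ i))" for i
      using \<phi> g by (intro set_integrable_lborel_ball continuous_intros)
    then show ?thesis
      by (simp add: J_def V_g distrib_left)
  qed
  \<comment> \<open>The one-coordinate identities for \<open>a\<close> and \<open>b\<close> are
    added; each contributes one copy of \<open>P\<close>.\<close>
  have "2 * P + 2 * J = 1 / R * (LINT x:sphere 0 R|sphere_measure R. ((x $ a)\<^sup>2 + (x $ b)\<^sup>2) * (\<phi> x)\<^sup>2)"
    unfolding sphere_split J_split P_def distrib_left
    by (simp only: integral_square_plus_radial_derivative[OF \<open>R > 0\<close> L g(1,3), symmetric])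
  then have J: "2 * P - 1 / R * (LINT x:sphere 0 R|sphere_measure R. ((x $ a)\<^sup>2 + (x $ b)\<^sup>2) * (\<phi> x)\<^sup>2) = - 2 * J"
    by simp
  let ?u = "\<lambda>x. \<phi> x *\<^sub>R V x"
  \<comment> \<open>A pointwise Cauchy--Schwarz bound reduces the vector fields to their norms, to
    which the integral inequality for real functions applies.\<close>
  have "\<bar>J\<bar> \<le> (LINT x:?B|lborel. norm (g x) * norm (?u x))"
  proof -
    have i1: "set_integrable lborel ?B (\<lambda>x. \<phi> x * (V x \<bullet> g x))"
      and i2: "set_integrable lborel ?B (\<lambda>x. norm (g x) * norm (?u x))"
      using \<phi> g V by (auto intro!: set_integrable_lborel_ball continuous_intros)
    have "\<bar>J\<bar> \<le> (LINT x:?B|lborel. \<bar>\<phi> x * (V x \<bullet> g x)\<bar>)"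
      unfolding J_def using set_integral_norm_bound[OF i1] by simp
    also have "\<dots> \<le> (LINT x:?B|lborel. norm (g x) * norm (?u x))"
    proof (rule set_integral_mono[OF set_integrable_abs[OF i1] i2])
      show "\<bar>\<phi> x * (V x \<bullet> g x)\<bar> \<le> norm (g x) * norm (?u x)" for x
        using Cauchy_Schwarz_ineq2[of "g x" "?u x"] by (simp add: inner_commute)
    qed
    finally show ?thesis .
  qed
  then have "J\<^sup>2 \<le> (LINT x:?B|lborel. norm (g x) * norm (?u x))\<^sup>2"
    by (metis abs_ge_zero power2_abs power_mono)
  also have "\<dots> \<le> (LINT x:?B|lborel. (norm (g x))\<^sup>2) * (LINT x:?B|lborel. (norm (?u x))\<^sup>2)"
    using \<phi> g V by (intro set_integral_Cauchy_Schwarz set_integrable_lborel_ball continuous_intros)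
  \<comment> \<open>The estimates use \<open>g\<close> for its continuity up to the sphere; on the
    open ball it equals the gradient.\<close>
  also have "(LINT x:?B|lborel. (norm (g x))\<^sup>2) = (LINT x:?B|lborel. (norm (gradient \<phi> x))\<^sup>2)"
    using g(2) by (intro set_lebesgue_integral_cong) auto
  also have "(LINT x:?B|lborel. (norm (?u x))\<^sup>2) = (LINT x:?B|lborel. ((x $ a)\<^sup>2 + (x $ b)\<^sup>2) * (\<phi> x)\<^sup>2)"
    by (simp add: power_mult_distrib norm_V mult.commute)
  \<comment> \<open>The quantity inside the square is \<open>- 2 * J\<close>, so
    \<open>A / 4\<close> is \<open>J\<^sup>2\<close>.\<close>
  finally show ?thesis
    unfolding Let_def power2_abs a_def[symmetric] b_def[symmetric] P_def[symmetric] J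
    by (simp add: power_mult_distrib)
qed

end
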